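(* Let $f^*$ be the probability density on $(0,2]$ described in the context, let $X$ be a random variable with density $f^*$, let $C=P(X>1)=\int_1^2 f^*(t)\,dt$ and $\mathbb{E}(X)=\int_0^2 tf^*(t)\,dt$. Then the rate of decay of remaining space $$R_{1/2}:=1-\frac{C}{\mathbb{E}(X)}$$ satisfies $R_{1/2}=0.616445\pm0.0035$, i.e. $|R_{1/2}-0.616445|\le 0.0035$.
   Context: $f^*$ is the probability density on $(0,2]$ of the form $f^*(t)=\ell^*\log(t)+\sum_{k=0}^\infty a_k^*(t-1)^k$ with $|\ell^*|+\sum_k|a_k^*|<\infty$ which satisfies $$(1+C)f^*(x)=\tfrac12 f^*(x/2)+\int_{1+x/2}^2\frac{f^*(y)}{y-1}\,dy\quad (x\in(0,2]),\qquad C=\int_1^2 f^*(y)\,dy .$$ It exists and is the limit, uniformly on compact subsets of $(0,2]$, of the iteration $(1+C_s)f_{s+1}(x)=\tfrac12 f_s(x/2)+\int_{1+x/2}^2\frac{f_s(y)}{y-1}\,dy$, $C_s=\int_1^2f_s$, started from any probability density $f_0(t)=\ell\log(t)+\sum_{k\ge0}a_k(t-1)^k$ with $(\ell,a_0,a_1,\dots)\in\ell^1$ (for example $f_0\equiv\frac12$). The quantity $R_{1/2}$ is the ratio of uncovered length after to before one stage: a large number $N$ of gaps distributed as $X$ has expected total length $N\mathbb{E}(X)$, and parking unit-length cars in them reduces the uncovered length to $N\mathbb{E}(X)-NP(X>1)$. *)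

theory Defs
  imports "HOL-Probability.Probability"
begin

(* The class of functions l log t + sum_k a_k (t - 1)^k with (l, a_0, a_1, ...) in l^1.
   Only the values on (0,2] are constrained; there |t - 1| <= 1, so the series converges. *)
definition log_power_form :: "(real \<Rightarrow> real) \<Rightarrow> bool" where
  "log_power_form f \<longleftrightarrow>
     (\<exists>(l::real) (a :: nat \<Rightarrow> real). summable (\<lambda>k. \<bar>a k\<bar>) \<and>
        (\<forall>t\<in>{0<..2}. f t = l * ln t + (\<Sum>k. a k * (t - 1) ^ k)))"

definition prob_density_02 :: "(real \<Rightarrow> real) \<Rightarrow> bool" where
  "prob_density_02 f \<longleftrightarrow>
     (\<forall>t\<in>{0<..2}. 0 \<le> f t) \<and>
     set_integrable lborel {0<..2} f \<and>
     (LBINT t:{0<..2}. f t) = 1"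

definition mass_above_1 :: "(real \<Rightarrow> real) \<Rightarrow> real" where
  "mass_above_1 f = (LBINT t:{1..2}. f t)"

definition stationary_gap_density :: "(real \<Rightarrow> real) \<Rightarrow> bool" where
  "stationary_gap_density f \<longleftrightarrow>
     prob_density_02 f \<and> log_power_form f \<and>
     (\<forall>x\<in>{0<..2}.
        (1 + mass_above_1 f) * f x
          = (1/2) * f (x/2) + (LBINT y:{1 + x/2..2}. f y / (y - 1)))"

definition decay_rate :: "'a measure \<Rightarrow> ('a \<Rightarrow> real) \<Rightarrow> real" where
  "decay_rate M X =
     1 - measure M {\<omega> \<in> space M. X \<omega> > 1} / (LINT \<omega>|M. X \<omega>)"

end

theory Submission
  imports Defs
begin

text \<open>Write \<open>T g x = g (x/2) / 2 + \<integral>\<^bsub>1 + x/2\<^esub>\<^bsup>2\<^esup> g y / (y - 1) dy\<close>, so that \<open>T f = (1 + C) f\<close>.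
  Integrating the equation against \<open>x\<close> gives \<open>(1 + C) E = 2 (E - C)\<close>, so the decay rate
  \<open>1 - C / E\<close> equals \<open>(1 + C) / 2\<close> and only the eigenvalue \<open>1 + C\<close> has to be located.
  As \<open>T\<close> is positive, a function \<open>w\<close> with \<open>T w \<le> m w\<close> and \<open>f \<le> K w\<close> yields
  \<open>f \<le> K (m / (1 + C))\<^sup>n w\<close> for all \<open>n\<close>, hence \<open>1 + C \<le> m\<close>; the reversed inequalities with
  \<open>K > 0\<close> yield \<open>m \<le> 1 + C\<close> (Collatz--Wielandt). Suitable \<open>w\<close> are quadratic on \<open>(1,2]\<close> and a
  logarithm plus a quadratic on \<open>(0,1]\<close>; they are comparable to \<open>1 + \<bar>ln x\<bar>\<close>, and so is \<open>f\<close>.\<close>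

section \<open>The gap operator: integrability and monotonicity\<close>

definition gap_operator :: "(real \<Rightarrow> real) \<Rightarrow> real \<Rightarrow> real" where
  "gap_operator g x = (1/2) * g (x/2) + (LBINT y:{1 + x/2..2}. g y / (y - 1))"

text \<open>The pole of \<open>1 / (y - 1)\<close> at 1 stays outside the range of integration:
  there \<open>y - 1\<close> is at least \<open>x/2\<close>, so the kernel is bounded by
  \<open>2/x\<close>.\<close>

lemma set_integrable_gap_kernel:
  fixes g :: "real \<Rightarrow> real"
  assumes "set_integrable lborel {0<..2} g" and "0 < x"
  shows "set_integrable lborel {1 + x/2..2} (\<lambda>y. g y / (y - 1))"
proof -
  have g: "set_integrable lborel {1 + x/2..2} g"
    by (rule set_integrable_subset[OF assms(1)]) (use assms(2) in auto)
  have "set_integrable lborel {1 + x/2..2} (\<lambda>y. (2/x) * g y)"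
    using g by (rule set_integrable_mult_right)
  then show ?thesis
    unfolding set_integrable_def
  proof (rule Bochner_Integration.integrable_bound)
    have "(\<lambda>y. indicator {1 + x/2..2} y *\<^sub>R g y) \<in> borel_measurable lborel"
      using g unfolding set_integrable_def by (rule borel_measurable_integrable)
    then have "(\<lambda>y. (indicator {1 + x/2..2} y *\<^sub>R g y) / (y - 1)) \<in> borel_measurable lborel"
      by measurable
    then show "(\<lambda>y. indicator {1 + x/2..2} y *\<^sub>R (g y / (y - 1))) \<in> borel_measurable lborel"
      by simp
    show "AE y in lborel. norm (indicator {1 + x/2..2} y *\<^sub>R (g y / (y - 1)))
            \<le> norm (indicator {1 + x/2..2} y *\<^sub>R ((2/x) * g y))"
    proof (rule AE_I2)
      fix y
      show "norm (indicator {1 + x/2..2} y *\<^sub>R (g y / (y - 1)))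
            \<le> norm (indicator {1 + x/2..2} y *\<^sub>R ((2/x) * g y))"
      proof (cases "y \<in> {1 + x/2..2}")
        case True
        then have "x/2 \<le> y - 1" by simp
        then have "1 / (y - 1) \<le> 1 / (x/2)"
          using assms(2) by (intro divide_left_mono) auto
        then have "\<bar>g y\<bar> * (1 / (y - 1)) \<le> \<bar>g y\<bar> * (1 / (x/2))"
          by (intro mult_left_mono) auto
        moreover have "0 < y - 1" using True assms(2) by simp
        ultimately show ?thesis
          using True assms(2) by (simp add: abs_mult mult.commute)
      qed simp
    qed
  qed
qed

lemma gap_operator_mono:
  assumes "set_integrable lborel {1 + x/2..2} (\<lambda>y. u y / (y - 1))"
    and "set_integrable lborel {1 + x/2..2} (\<lambda>y. v y / (y - 1))"
    and "\<And>y. y \<in> {0<..2} \<Longrightarrow> u y \<le> v y" and "x \<in> {0<..2}"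
  shows "gap_operator u x \<le> gap_operator v x"
proof -
  have "(LBINT y:{1 + x/2..2}. u y / (y - 1)) \<le> (LBINT y:{1 + x/2..2}. v y / (y - 1))"
    using assms by (intro set_integral_mono divide_right_mono) auto
  moreover have "u (x/2) \<le> v (x/2)"
    using assms(3)[of "x/2"] assms(4) by auto
  ultimately show ?thesis
    unfolding gap_operator_def by simp
qed

lemma gap_operator_cmult: "gap_operator (\<lambda>y. c * w y) x = c * gap_operator w x"
  by (simp add: gap_operator_def set_lebesgue_integral_def algebra_simps flip: Bochner_Integration.integral_mult_right_zero)

section \<open>Trial functions and their images\<close>

text \<open>On \<open>(0,1]\<close> the trial function has the form \<open>- a ln x + q\<^sub>0 + q\<^sub>1 x + q\<^sub>2 x\<^sup>2\<close>, whose
  coefficients are determined by those on \<open>(1,2]\<close> through the requirement that the operator maps the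
  trial function to exactly \<open>m\<close> times this expression, on all of \<open>(0,2]\<close>.\<close>

definition log_branch :: "real \<Rightarrow> real \<Rightarrow> real \<Rightarrow> real \<Rightarrow> real" where
  "log_branch m p1 p2 x =
     - (1 / (m - 1/2)) * ln x + (m / (m - 1/2) * ln 2 + p1 + p2/2) / (m - 1/2)
     - p1 / (2*m - 1/2) * x - p2 / (8*m - 1) * x\<^sup>2"

definition trial :: "real \<Rightarrow> real \<Rightarrow> real \<Rightarrow> real \<Rightarrow> real" where
  "trial m p1 p2 x =
     (if x \<le> 1 then log_branch m p1 p2 x else 1 + p1 * (x - 1) + p2 * (x - 1)\<^sup>2)"

text \<open>As \<open>1 + x/2 > 1\<close>, the integral sees only the quadratic branch. Its constant
  term 1 produces the logarithm, and \<open>m\<close> does not enter the value, so the logarithmic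
  branch can be solved for afterwards.\<close>

lemma has_bochner_integral_trial_kernel:
  assumes "x \<in> {0<..2}"
  shows "has_bochner_integral lborel
     (\<lambda>y. indicator {1 + x/2..2} y *\<^sub>R (trial m p1 p2 y / (y - 1)))
     (p1 * (1 - x/2) + p2/2 * (1 - (x/2)\<^sup>2) - ln (x/2))"
proof -
  define F where "F y = ln (y - 1) + p1 * (y - 1) + p2/2 * (y - 1)\<^sup>2" for y :: real
  have "has_bochner_integral lborel
     (\<lambda>y. indicator {1 + x/2..2} y *\<^sub>R (1 / (y - 1) + p1 + p2 * (y - 1))) (F 2 - F (1 + x/2))"
  proof (rule has_bochner_integral_FTC_Icc)
    show "1 + x/2 \<le> 2" using assms by simp
    fix y assume y: "1 + x/2 \<le> y" "y \<le> 2"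
    then have "0 < y - 1" using assms by auto
    then have "(F has_real_derivative (1 / (y - 1) + p1 + p2 * (y - 1))) (at y)"
      unfolding F_def by (auto intro!: derivative_eq_intros)
    then show "(F has_vector_derivative (1 / (y - 1) + p1 + p2 * (y - 1))) (at y within {1 + x/2..2})"
      using has_field_derivative_at_within has_real_derivative_iff_has_vector_derivative by blast
  next
    show "continuous_on {1 + x/2..2} (\<lambda>y. 1 / (y - 1) + p1 + p2 * (y - 1))"
      using assms by (intro continuous_intros) auto
  qed
  moreover have "indicator {1 + x/2..2} y *\<^sub>R (1 / (y - 1) + p1 + p2 * (y - 1))
      = indicator {1 + x/2..2} y *\<^sub>R (trial m p1 p2 y / (y - 1))" for y
  proof (cases "y \<in> {1 + x/2..2}")
    case True
    then have "1 < y" using assms by auto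
    then show ?thesis
      by (simp add: trial_def field_simps power2_eq_square)
  qed simp
  moreover have "F 2 - F (1 + x/2) = p1 * (1 - x/2) + p2/2 * (1 - (x/2)\<^sup>2) - ln (x/2)"
    by (simp add: F_def algebra_simps)
  ultimately show ?thesis
    by simp
qed

text \<open>Since \<open>x/2 <= 1\<close>, the first term of the operator sees only the logarithmic
  branch. Comparing coefficients of \<open>ln x\<close>, 1, \<open>x\<close> and \<open>x^2\<close>
  gives four linear equations. Halving the argument and the value scales \<open>x^k\<close> by
  \<open>1 / 2^(k+1)\<close>, hence the divisors \<open>m - 1/2\<close>, \<open>2*m - 1/2\<close>
  and \<open>8*m - 1\<close>, all positive for \<open>m > 1/2\<close>.\<close>

lemma gap_operator_trial:
  assumes "1/2 < m" and "x \<in> {0<..2}"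
  shows "gap_operator (trial m p1 p2) x = m * log_branch m p1 p2 x"
proof -
  define L where "L = ln (2::real)"
  define l where "l = ln x"
  define a where "a = 1 / (m - 1/2)"
  define q1 where "q1 = p1 / (2*m - 1/2)"
  define q2 where "q2 = p2 / (8*m - 1)"
  define q0 where "q0 = (m / (m - 1/2) * L + p1 + p2/2) / (m - 1/2)"
  have br: "log_branch m p1 p2 z = - a * ln z + q0 - q1 * z - q2 * z\<^sup>2" for z
    by (simp add: log_branch_def a_def q0_def q1_def q2_def L_def)
  have "(m - 1/2) * a = 1" using assms(1) by (simp add: a_def)
  then have a: "m * a = a/2 + 1" by (simp add: algebra_simps)
  have "(m - 1/2) * q0 = m * a * L + p1 + p2/2" using assms(1) by (simp add: q0_def a_def)
  then have q0: "m * q0 = q0/2 + m * a * L + p1 + p2/2" by (simp add: algebra_simps)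
  have "(2*m - 1/2) * q1 = p1" using assms(1) by (simp add: q1_def)
  then have q1: "m * q1 = q1/4 + p1/2" by (simp add: algebra_simps)
  have "(8*m - 1) * q2 = p2" using assms(1) by (simp add: q2_def)
  then have q2: "m * q2 = q2/8 + p2/8" by (simp add: algebra_simps)
  have "(LBINT y:{1 + x/2..2}. trial m p1 p2 y / (y - 1))
      = p1 * (1 - x/2) + p2/2 * (1 - (x/2)\<^sup>2) - (l - L)"
    unfolding set_lebesgue_integral_def
    using has_bochner_integral_integral_eq[OF has_bochner_integral_trial_kernel[OF assms(2)]] assms(2)
    by (simp add: ln_div l_def L_def)
  moreover have "trial m p1 p2 (x/2) = - a * (l - L) + q0 - q1 * (x/2) - q2 * (x/2)\<^sup>2"
    using assms(2) by (simp add: trial_def br ln_div l_def L_def)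
  ultimately have "gap_operator (trial m p1 p2) x
     = - (a/2 + 1) * l + (a/2 + 1) * L + q0/2 + p1 + p2/2 - (q1/4 + p1/2) * x - (q2/8 + p2/8) * x\<^sup>2"
    unfolding gap_operator_def by (simp add: field_simps power2_eq_square)
  also have "\<dots> = - (m * a) * l + m * q0 - m * q1 * x - m * q2 * x\<^sup>2"
    using q0 by (simp add: a q1 q2)
  also have "\<dots> = m * log_branch m p1 p2 x"
    by (simp add: br l_def algebra_simps)
  finally show ?thesis .
qed

section \<open>Collatz-Wielandt bounds for the eigenvalue\<close>

text \<open>Applying the monotone operator to both sides gains a factor \<open>m / lam\<close> per
  step. On (0,1] the two branches coincide, so the branches have to be compared only on
  (1,2].\<close>

lemma eigenfunction_le_trial_iterate:
  assumes "set_integrable lborel {0<..2} f"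
    and "\<And>x. x \<in> {0<..2} \<Longrightarrow> lam * f x = gap_operator f x" and "0 < lam"
    and "1/2 < m" and "0 \<le> K"
    and "\<And>x. x \<in> {1<..2} \<Longrightarrow> log_branch m p1 p2 x \<le> trial m p1 p2 x"
    and "\<And>x. x \<in> {0<..2} \<Longrightarrow> f x \<le> K * trial m p1 p2 x"
  shows "x \<in> {0<..2} \<Longrightarrow> f x \<le> K * (m / lam) ^ n * trial m p1 p2 x"
proof (induction n arbitrary: x)
  case 0
  then show ?case using assms(7) by simp
next
  case (Suc n)
  let ?c = "K * (m / lam) ^ n"
  have c: "0 \<le> ?c" using assms by simp
  have "lam * f x = gap_operator f x" using assms(2) Suc by simp
  also have "\<dots> \<le> gap_operator (\<lambda>y. ?c * trial m p1 p2 y) x"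
  proof (rule gap_operator_mono)
    show "set_integrable lborel {1 + x/2..2} (\<lambda>y. f y / (y - 1))"
      using set_integrable_gap_kernel[OF assms(1)] Suc by simp
    have "set_integrable lborel {1 + x/2..2} (\<lambda>y. trial m p1 p2 y / (y - 1))"
      unfolding set_integrable_def
      using has_bochner_integral_trial_kernel[OF Suc.prems] by (rule integrable.intros)
    from set_integrable_mult_right[OF this, of ?c]
    show "set_integrable lborel {1 + x/2..2} (\<lambda>y. ?c * trial m p1 p2 y / (y - 1))" by simp
  qed (use Suc in auto)
  also have "\<dots> = ?c * (m * log_branch m p1 p2 x)"
    using gap_operator_trial assms(4) Suc by (simp add: gap_operator_cmult)
  also have "\<dots> \<le> ?c * (m * trial m p1 p2 x)"
  proof -
    have "log_branch m p1 p2 x \<le> trial m p1 p2 x"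
      using assms(6)[of x] Suc by (cases "x \<le> 1") (auto simp: trial_def)
    then show ?thesis using c assms(4) by (intro mult_left_mono) auto
  qed
  finally show ?case
    using assms(3) by (simp add: field_simps)
qed

lemma trial_iterate_le_eigenfunction:
  assumes "set_integrable lborel {0<..2} f"
    and "\<And>x. x \<in> {0<..2} \<Longrightarrow> lam * f x = gap_operator f x" and "0 < lam"
    and "1/2 < m" and "0 \<le> K"
    and "\<And>x. x \<in> {1<..2} \<Longrightarrow> trial m p1 p2 x \<le> log_branch m p1 p2 x"
    and "\<And>x. x \<in> {0<..2} \<Longrightarrow> K * trial m p1 p2 x \<le> f x"
  shows "x \<in> {0<..2} \<Longrightarrow> K * (m / lam) ^ n * trial m p1 p2 x \<le> f x"
proof (induction n arbitrary: x)
  case 0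
  then show ?case using assms(7) by simp
next
  case (Suc n)
  let ?c = "K * (m / lam) ^ n"
  have c: "0 \<le> ?c" using assms by simp
  have "?c * (m * trial m p1 p2 x) \<le> ?c * (m * log_branch m p1 p2 x)"
  proof -
    have "trial m p1 p2 x \<le> log_branch m p1 p2 x"
      using assms(6)[of x] Suc by (cases "x \<le> 1") (auto simp: trial_def)
    then show ?thesis using c assms(4) by (intro mult_left_mono) auto
  qed
  also have "\<dots> = gap_operator (\<lambda>y. ?c * trial m p1 p2 y) x"
    using gap_operator_trial assms(4) Suc by (simp add: gap_operator_cmult)
  also have "\<dots> \<le> gap_operator f x"
  proof (rule gap_operator_mono)
    show "set_integrable lborel {1 + x/2..2} (\<lambda>y. f y / (y - 1))"
      using set_integrable_gap_kernel[OF assms(1)] Suc by simp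
    have "set_integrable lborel {1 + x/2..2} (\<lambda>y. trial m p1 p2 y / (y - 1))"
      unfolding set_integrable_def
      using has_bochner_integral_trial_kernel[OF Suc.prems] by (rule integrable.intros)
    from set_integrable_mult_right[OF this, of ?c]
    show "set_integrable lborel {1 + x/2..2} (\<lambda>y. ?c * trial m p1 p2 y / (y - 1))" by simp
  qed (use Suc in auto)
  also have "\<dots> = lam * f x" using assms(2) Suc by simp
  finally show ?case
    using assms(3) by (simp add: field_simps)
qed

text \<open>If \<open>m < lam\<close>, the iterated bound at the point 2 tends to 0, against
  \<open>0 < f 2\<close>.\<close>

lemma eigenvalue_upper_bound:
  assumes "set_integrable lborel {0<..2} f"
    and "\<And>x. x \<in> {0<..2} \<Longrightarrow> lam * f x = gap_operator f x" and "0 < lam"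
    and "1/2 < m" and "0 \<le> K"
    and "\<And>x. x \<in> {1<..2} \<Longrightarrow> log_branch m p1 p2 x \<le> trial m p1 p2 x"
    and "\<And>x. x \<in> {0<..2} \<Longrightarrow> f x \<le> K * trial m p1 p2 x"
    and "0 < f 2"
  shows "lam \<le> m"
proof (rule ccontr)
  assume "\<not> lam \<le> m"
  then have "(\<lambda>n. (m / lam) ^ n) \<longlonglongrightarrow> 0"
    using assms(3,4) by (intro LIMSEQ_realpow_zero) auto
  then have "(\<lambda>n. K * (m / lam) ^ n * trial m p1 p2 2) \<longlonglongrightarrow> K * 0 * trial m p1 p2 2"
    by (intro tendsto_mult tendsto_const)
  moreover have "f 2 \<le> K * (m / lam) ^ n * trial m p1 p2 2" for n
    by (rule eigenfunction_le_trial_iterate[OF assms(1-7)]) auto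
  ultimately have "f 2 \<le> K * 0 * trial m p1 p2 2"
    by (intro LIMSEQ_le_const) auto
  then show False using assms(8) by simp
qed

text \<open>If \<open>lam < m\<close>, the iterated lower bound at the point 2 grows beyond the
  fixed number \<open>f 2\<close>.\<close>

lemma eigenvalue_lower_bound:
  assumes "set_integrable lborel {0<..2} f"
    and "\<And>x. x \<in> {0<..2} \<Longrightarrow> lam * f x = gap_operator f x" and "0 < lam"
    and "1/2 < m" and "0 < K"
    and "\<And>x. x \<in> {1<..2} \<Longrightarrow> trial m p1 p2 x \<le> log_branch m p1 p2 x"
    and "\<And>x. x \<in> {0<..2} \<Longrightarrow> K * trial m p1 p2 x \<le> f x"
    and "0 < trial m p1 p2 2"
  shows "m \<le> lam"
proof (rule ccontr)
  assume "\<not> m \<le> lam"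
  then have "1 < m / lam" using assms(3) by simp
  then obtain n where n: "f 2 / (K * trial m p1 p2 2) < (m / lam) ^ n"
    using real_arch_pow by blast
  have "K * (m / lam) ^ n * trial m p1 p2 2 \<le> f 2"
    by (rule trial_iterate_le_eigenfunction[OF assms(1-4) less_imp_le[OF assms(5)] assms(6,7)]) auto
  with n show False using assms(5,8) by (simp add: field_simps)
qed

section \<open>Comparison of the two branches on (1,2]\<close>

text \<open>The derivative of the difference is \<open>(1 - 2x/3)\<^sup>4 / x\<close>.\<close>

lemma ln_minus_quartic_mono:
  fixes x y :: real
  assumes "0 < x" and "x \<le> y"
  shows "ln x - (8/3 * x - 4/3 * x^2 + 32/81 * x^3 - 4/81 * x^4)
       \<le> ln y - (8/3 * y - 4/3 * y^2 + 32/81 * y^3 - 4/81 * y^4)"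
proof -
  let ?h = "\<lambda>x::real. ln x - (8/3 * x - 4/3 * x^2 + 32/81 * x^3 - 4/81 * x^4)"
  have "?h x \<le> ?h y"
  proof (rule DERIV_nonneg_imp_nondecreasing[OF assms(2)])
    fix z assume "x \<le> z" "z \<le> y"
    then have z: "0 < z" using assms by simp
    have "(?h has_real_derivative (1 - 2*z/3)^4 / z) (at z)"
      using z by (auto intro!: derivative_eq_intros simp: field_simps eval_nat_numeral)
    moreover have "0 \<le> (1 - 2*z/3)^4 / z" using z by simp
    ultimately show "\<exists>d. (?h has_real_derivative d) (at z) \<and> 0 \<le> d" by blast
  qed
  then show ?thesis by simp
qed

lemma ln_2_bounds: "693/1000 \<le> ln (2::real)" "ln (2::real) \<le> 1733/2500"
  using ln_approx_bounds[of 2 3] by (simp_all add: eval_nat_numeral)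

text \<open>For \<open>m = 1.239\<close> and \<open>m = 1.227\<close> the quadratics were found by numerically maximising the smallest
  value on \<open>[1,2]\<close> of the signed difference between the two branches; it is about \<open>0.004\<close> in both
  cases. The eigenvalue itself is about \<open>1.23289\<close>.\<close>

lemma log_branch_upper_eq:
  "log_branch (1239/1000) (- 22/25) (3/10) x =
     1239000/546121 * ln 2 - 730/739 - 1000/739 * ln x + 440/989 * x - 75/2228 * x\<^sup>2"
  by (simp add: log_branch_def)

lemma log_branch_lower_eq:
  "log_branch (1227/1000) (- 21/25) (1/4) x =
     1227000/528529 * ln 2 - 715/727 - 1000/727 * ln x + 420/977 * x - 125/4408 * x\<^sup>2"
  by (simp add: log_branch_def)

lemma trial_upper_eq:
  "1 < x \<Longrightarrow> trial (1239/1000) (- 22/25) (3/10) x = 109/50 - 37/25 * x + 3/10 * x\<^sup>2"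
  by (simp add: trial_def power2_eq_square field_simps)

lemma trial_lower_eq:
  "1 < x \<Longrightarrow> trial (1227/1000) (- 21/25) (1/4) x = 209/100 - 67/50 * x + 1/4 * x\<^sup>2"
  by (simp add: trial_def power2_eq_square field_simps)

text \<open>A quartic on an interval is checked by expressing it as a nonnegative combination of
  Bernstein polynomials.\<close>

lemma bernstein_1_32:
  fixes x :: real
  assumes "1 \<le> x" "x \<le> 3/2"
  shows "0 \<le> 16 * x^4 - 96 * x^3 + 216 * x^2 - 216 * x + 81" and
    "0 \<le> - 8 * x^4 + 44 * x^3 - 90 * x^2 + 81 * x - 27" and
    "0 \<le> 4 * x^4 - 20 * x^3 + 37 * x^2 - 30 * x + 9" and
    "0 \<le> - 2 * x^4 + 9 * x^3 - 15 * x^2 + 11 * x - 3" and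
    "0 \<le> x^4 - 4 * x^3 + 6 * x^2 - 4 * x + 1"
proof -
  have "0 \<le> (x - 1)" "0 \<le> (3 - 2 * x)" using assms by simp_all
  then have "0 \<le> (3 - 2 * x)^4"
    "0 \<le> (x - 1)^1 * (3 - 2 * x)^3"
    "0 \<le> (x - 1)^2 * (3 - 2 * x)^2"
    "0 \<le> (x - 1)^3 * (3 - 2 * x)^1"
    "0 \<le> (x - 1)^4"
    by simp_all
  then show "0 \<le> 16 * x^4 - 96 * x^3 + 216 * x^2 - 216 * x + 81"
    "0 \<le> - 8 * x^4 + 44 * x^3 - 90 * x^2 + 81 * x - 27"
    "0 \<le> 4 * x^4 - 20 * x^3 + 37 * x^2 - 30 * x + 9"
    "0 \<le> - 2 * x^4 + 9 * x^3 - 15 * x^2 + 11 * x - 3"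
    "0 \<le> x^4 - 4 * x^3 + 6 * x^2 - 4 * x + 1"
    by (simp_all add: algebra_simps eval_nat_numeral)
qed

lemma bernstein_32_2:
  fixes x :: real
  assumes "3/2 \<le> x" "x \<le> 2"
  shows "0 \<le> x^4 - 8 * x^3 + 24 * x^2 - 32 * x + 16" and
    "0 \<le> - 2 * x^4 + 15 * x^3 - 42 * x^2 + 52 * x - 24" and
    "0 \<le> 4 * x^4 - 28 * x^3 + 73 * x^2 - 84 * x + 36" and
    "0 \<le> - 8 * x^4 + 52 * x^3 - 126 * x^2 + 135 * x - 54" and
    "0 \<le> 16 * x^4 - 96 * x^3 + 216 * x^2 - 216 * x + 81"
proof -
  have "0 \<le> (2 * x - 3)" "0 \<le> (2 - x)" using assms by simp_all
  then have "0 \<le> (2 - x)^4"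
    "0 \<le> (2 * x - 3)^1 * (2 - x)^3"
    "0 \<le> (2 * x - 3)^2 * (2 - x)^2"
    "0 \<le> (2 * x - 3)^3 * (2 - x)^1"
    "0 \<le> (2 * x - 3)^4"
    by simp_all
  then show "0 \<le> x^4 - 8 * x^3 + 24 * x^2 - 32 * x + 16"
    "0 \<le> - 2 * x^4 + 15 * x^3 - 42 * x^2 + 52 * x - 24"
    "0 \<le> 4 * x^4 - 28 * x^3 + 73 * x^2 - 84 * x + 36"
    "0 \<le> - 8 * x^4 + 52 * x^3 - 126 * x^2 + 135 * x - 54"
    "0 \<le> 16 * x^4 - 96 * x^3 + 216 * x^2 - 216 * x + 81"
    by (simp_all add: algebra_simps eval_nat_numeral)
qed

text \<open>\<open>ln x\<close> enters \<open>log_branch\<close> with a negative coefficient, so it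
  is replaced by a lower bound, and \<open>ln 2\<close> by its upper bound. What remains is a
  quartic inequality, linear in the powers of \<open>x\<close> and hence in the Bernstein
  polynomials.\<close>

lemma log_branch_le_trial:
  assumes "x \<in> {1<..2}"
  shows "log_branch (1239/1000) (- 22/25) (3/10) x \<le> trial (1239/1000) (- 22/25) (3/10) x"
proof -
  \<comment> \<open>Up to its constant term the quartic is the Taylor polynomial of
    \<open>ln\<close> at 3/2, the midpoint of [1,2]. Monotonicity of the difference turns the
    comparison with the left endpoint 1 into a lower bound; 136/81 is the value of the quartic
    there.\<close>
  have l: "8/3 * x - 4/3 * x^2 + 32/81 * x^3 - 4/81 * x^4 - 136/81 \<le> ln x"
    using ln_minus_quartic_mono[of 1 x] assms by simp
  have t: "trial (1239/1000) (- 22/25) (3/10) x = 109/50 - 37/25 * x + 3/10 * x\<^sup>2"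
    using trial_upper_eq assms by simp
  show ?thesis
  proof (cases "x \<le> 3/2")
    case True
    have "1 \<le> x" using assms by simp
    from bernstein_1_32[OF this True] l ln_2_bounds show ?thesis
      unfolding log_branch_upper_eq t by linarith
  next
    case False
    have "3/2 \<le> x" "x \<le> 2" using assms False by auto
    from bernstein_32_2[OF this] l ln_2_bounds show ?thesis
      unfolding log_branch_upper_eq t by linarith
  qed
qed

lemma trial_le_log_branch:
  assumes "x \<in> {1<..2}"
  shows "trial (1227/1000) (- 21/25) (1/4) x \<le> log_branch (1227/1000) (- 21/25) (1/4) x"
proof -
  \<comment> \<open>Here an upper bound is needed, so the comparison is with the right endpoint 2,
    where the quartic equals 64/27. The total coefficient of \<open>ln 2\<close> in the resulting
    bound stays positive, so its lower bound is the one that matters.\<close>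
  have l: "ln x \<le> ln 2 + 8/3 * x - 4/3 * x^2 + 32/81 * x^3 - 4/81 * x^4 - 64/27"
    using ln_minus_quartic_mono[of x 2] assms by simp
  have t: "trial (1227/1000) (- 21/25) (1/4) x = 209/100 - 67/50 * x + 1/4 * x\<^sup>2"
    using trial_lower_eq assms by simp
  show ?thesis
  proof (cases "x \<le> 3/2")
    case True
    have "1 \<le> x" using assms by simp
    from bernstein_1_32[OF this True] l ln_2_bounds show ?thesis
      unfolding log_branch_lower_eq t by linarith
  next
    case False
    have "3/2 \<le> x" "x \<le> 2" using assms False by auto
    from bernstein_32_2[OF this] l ln_2_bounds show ?thesis
      unfolding log_branch_lower_eq t by linarith
  qed
qed

section \<open>Comparison with the logarithm\<close>

text \<open>Together with an upper bound of \<open>f\<close> by a multiple of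
  \<open>1 + \<bar>ln x\<bar>\<close>, this starts the iteration from above.\<close>

lemma trial_ge_log:
  assumes "x \<in> {0<..2}"
  shows "1/5 * (1 + \<bar>ln x\<bar>) \<le> trial (1239/1000) (- 22/25) (3/10) x"
proof (cases "x \<le> 1")
  case True
  then have "ln x \<le> 0" "x^2 \<le> x" "0 < x"
    using assms by (auto simp: power2_eq_square mult_left_le)
  moreover have t: "trial (1239/1000) (- 22/25) (3/10) x = log_branch (1239/1000) (- 22/25) (3/10) x"
    using True by (simp add: trial_def)
  ultimately show ?thesis
    using ln_2_bounds unfolding t log_branch_upper_eq distrib_left by linarith
next
  case False
  then have "1 < x" by simp
  have "0 \<le> ln x" "ln x \<le> ln 2" using False assms by auto
  \<comment> \<open>The tangent of \<open>x^2\<close> at 2 leaves a decreasing linear function, so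
    the worst case is \<open>x = 2\<close>.\<close>
  moreover have "0 \<le> (x - 2)^2" by simp
  then have "0 \<le> x^2 - 4 * x + 4" by (simp add: power2_eq_square algebra_simps)
  ultimately show ?thesis
    using assms ln_2_bounds unfolding trial_upper_eq[OF \<open>1 < x\<close>] distrib_left greaterThanAtMost_iff by linarith
qed

lemma trial_le_log:
  assumes "x \<in> {0<..2}"
  shows "trial (1227/1000) (- 21/25) (1/4) x \<le> 2 * (1 + \<bar>ln x\<bar>)"
proof (cases "x \<le> 1")
  case True
  then have "ln x \<le> 0" "0 \<le> x^2" using assms by auto
  moreover have t: "trial (1227/1000) (- 21/25) (1/4) x = log_branch (1227/1000) (- 21/25) (1/4) x"
    using True by (simp add: trial_def)
  ultimately show ?thesis
    using True ln_2_bounds unfolding t log_branch_lower_eq distrib_left by linarith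
next
  case False
  then have "1 < x" by simp
  \<comment> \<open>The chord of \<open>x^2\<close> over [1,2] bounds it from above.\<close>
  then have "0 \<le> (x - 1) * (2 - x)" using assms by simp
  then have "x^2 \<le> 3 * x - 2" by (simp add: power2_eq_square algebra_simps)
  moreover have "0 \<le> ln x" using False by simp
  ultimately show ?thesis
    using \<open>1 < x\<close> unfolding trial_lower_eq[OF \<open>1 < x\<close>] distrib_left by linarith
qed

text \<open>Since \<open>\<bar>t - 1\<bar> <= 1\<close> on (0,2], the power series is bounded by the
  sum of the \<open>\<bar>a k\<bar>\<close>.\<close>

lemma log_power_form_bound:
  assumes "log_power_form f"
  obtains B where "0 \<le> B" and "\<And>t. t \<in> {0<..2} \<Longrightarrow> \<bar>f t\<bar> \<le> B * (1 + \<bar>ln t\<bar>)"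
proof -
  from assms obtain l a where a: "summable (\<lambda>k. \<bar>a k\<bar>)"
    and f: "\<And>t. t \<in> {0<..2} \<Longrightarrow> f t = l * ln t + (\<Sum>k. a k * (t - 1) ^ k)"
    unfolding log_power_form_def by blast
  define S where "S = (\<Sum>k. \<bar>a k\<bar>)"
  have S: "0 \<le> S" unfolding S_def by (intro suminf_nonneg a) simp
  have "\<bar>f t\<bar> \<le> (\<bar>l\<bar> + S) * (1 + \<bar>ln t\<bar>)" if t: "t \<in> {0<..2}" for t
  proof -
    have "\<bar>t - 1\<bar> \<le> 1" using t by auto
    then have le: "\<bar>a k * (t - 1) ^ k\<bar> \<le> \<bar>a k\<bar>" for k
      by (simp add: abs_mult power_abs mult_left_le power_le_one)
    then have s: "summable (\<lambda>k. \<bar>a k * (t - 1) ^ k\<bar>)"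
      by (intro summable_comparison_test'[OF a, of 0]) simp
    have "\<bar>\<Sum>k. a k * (t - 1) ^ k\<bar> \<le> (\<Sum>k. \<bar>a k * (t - 1) ^ k\<bar>)"
      by (rule summable_rabs[OF s])
    also have "\<dots> \<le> S"
      unfolding S_def by (intro suminf_le le s a)
    finally have "\<bar>f t\<bar> \<le> \<bar>l\<bar> * \<bar>ln t\<bar> + S"
      unfolding f[OF t] by (intro order_trans[OF abs_triangle_ineq]) (simp add: abs_mult)
    moreover have "0 \<le> S * \<bar>ln t\<bar>" using S by simp
    ultimately show ?thesis by (simp add: algebra_simps)
  qed
  with S show thesis by (intro that[of "\<bar>l\<bar> + S"]) auto
qed

lemma set_lborel_integral_Ioc_eq_Icc: "(LBINT t:{a<..b::real}. f t :: real) = (LBINT t:{a..b}. f t)"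
  by (rule set_integral_discrete_difference[where X = "{a}"]) auto

lemma set_lborel_integral_nonneg:
  fixes g :: "real \<Rightarrow> real"
  assumes "\<And>t. t \<in> A \<Longrightarrow> 0 \<le> g t"
  shows "0 \<le> (LBINT t:A. g t)"
  unfolding set_lebesgue_integral_def using assms
  by (intro Bochner_Integration.integral_nonneg) (auto simp: indicator_def)

section \<open>Moments and positivity for a stationary density\<close>

context
  fixes f :: "real \<Rightarrow> real"
  assumes stat: "stationary_gap_density f"
begin

lemma density_nonneg: "t \<in> {0<..2} \<Longrightarrow> 0 \<le> f t"
  and density_integrable: "set_integrable lborel {0<..2} f"
  and density_integral: "(LBINT t:{0<..2}. f t) = 1"
  using stat by (auto simp: stationary_gap_density_def prob_density_02_def)

lemma density_gap_operator: "x \<in> {0<..2} \<Longrightarrow> (1 + mass_above_1 f) * f x = gap_operator f x"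
  using stat by (simp add: stationary_gap_density_def gap_operator_def)

lemma density_measurable: "(\<lambda>t. indicator {0<..2} t * f t) \<in> borel_measurable lborel"
  using density_integrable unfolding set_integrable_def real_scaleR_def
  by (rule borel_measurable_integrable)

lemma mass_above_1_nonneg: "0 \<le> mass_above_1 f"
  unfolding mass_above_1_def by (intro set_lborel_integral_nonneg density_nonneg) auto

lemma mult_density_integrable: "set_integrable lborel {0<..2} (\<lambda>t. t * f t)"
proof -
  have "set_integrable lborel {0<..2} (\<lambda>t. 2 * f t)"
    using density_integrable by (rule set_integrable_mult_right)
  then show ?thesis
    unfolding set_integrable_def
  proof (rule Bochner_Integration.integrable_bound)
    have "(\<lambda>t. t * (indicator {0<..2} t * f t)) \<in> borel_measurable lborel"
      using density_measurable by measurable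
    then show "(\<lambda>t. indicator {0<..2} t *\<^sub>R (t * f t)) \<in> borel_measurable lborel"
      by (simp add: mult.left_commute)
    show "AE t in lborel. norm (indicator {0<..2} t *\<^sub>R (t * f t))
        \<le> norm (indicator {0<..2} t *\<^sub>R (2 * f t))"
      by (intro AE_I2) (auto simp: indicator_def abs_mult intro!: mult_right_mono)
  qed
qed

text \<open>Tonelli: for fixed \<open>y\<close> the variable \<open>x\<close> runs up to
  \<open>2 * (y - 1)\<close>, the integral of \<open>x\<close> is \<open>2 * (y - 1)^2\<close>, and
  one factor cancels the denominator.\<close>

lemma tail_integral_moment:
  "(LBINT x:{0<..2}. x * (LBINT y:{1 + x/2..2}. f y / (y - 1))) = (LBINT y:{1..2}. 2 * (y - 1) * f y)"
proof -
  define h where "h x = (LBINT y:{1 + x/2..2}. f y / (y - 1))" for x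
  define g where "g y = (indicator {0<..2} y * f y) / (y - 1)" for y
  have g[measurable]: "g \<in> borel_measurable lborel"
    unfolding g_def using density_measurable by measurable
  \<comment> \<open>Including \<open>x = 0\<close> is harmless because of the factor
    \<open>x\<close> and gives a closed interval for the fundamental theorem; \<open>x <= 2\<close>
    follows from the other conditions.\<close>
  define F where "F x y = ennreal (if 0 \<le> x \<and> 1 + x/2 \<le> y \<and> y \<le> 2 then x * g y else 0)" for x y :: real
  have "case_prod F \<in> borel_measurable (lborel \<Otimes>\<^sub>M lborel)"
    unfolding F_def by measurable
  then have swap: "(\<integral>\<^sup>+ x. \<integral>\<^sup>+ y. F x y \<partial>lborel \<partial>lborel) = (\<integral>\<^sup>+ y. \<integral>\<^sup>+ x. F x y \<partial>lborel \<partial>lborel)"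
    by (intro lborel_pair.Fubini'[symmetric]) (simp add: split_def)
  have inner_y: "(\<integral>\<^sup>+ y. F x y \<partial>lborel) = ennreal (indicator {0<..2} x * (x * h x))" for x
  proof (cases "x \<in> {0<..2}")
    case True
    have "set_integrable lborel {1 + x/2..2} (\<lambda>y. f y / (y - 1))"
      using set_integrable_gap_kernel[OF density_integrable] True by simp
    then have "set_integrable lborel {1 + x/2..2} (\<lambda>y. x * (f y / (y - 1)))"
      by (rule set_integrable_mult_right)
    then have "(\<integral>\<^sup>+ y. ennreal (indicator {1 + x/2..2} y * (x * (f y / (y - 1)))) \<partial>lborel)
        = ennreal (LBINT y:{1 + x/2..2}. x * (f y / (y - 1)))"
      unfolding set_integrable_def set_lebesgue_integral_def real_scaleR_def
      using True density_nonneg by (intro nn_integral_eq_integral) (auto simp: indicator_def)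
    moreover have "ennreal (indicator {1 + x/2..2} y * (x * (f y / (y - 1)))) = F x y" for y
      using True by (auto simp: F_def g_def indicator_def)
    ultimately show ?thesis
      using True by (simp add: h_def del: times_divide_eq_right)
  next
    case False
    then have "F x y = 0" for y by (auto simp: F_def)
    then show ?thesis using False by simp
  qed
  have inner_x: "(\<integral>\<^sup>+ x. F x y \<partial>lborel) = ennreal (indicator {1..2} y * (2 * (y - 1) * f y))" for y
  proof (cases "y \<in> {1<..2}")
    case True
    have "0 \<le> g y" using True density_nonneg[of y] by (simp add: g_def)
    then have "(\<integral>\<^sup>+ x. ennreal (x * g y) * indicator {0..2 * (y - 1)} x \<partial>lborel)
        = ennreal ((2 * (y - 1))\<^sup>2 / 2 * g y - 0\<^sup>2 / 2 * g y)"
      using True by (intro nn_integral_FTC_Icc) (auto intro!: derivative_eq_intros)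
    moreover have "ennreal (x * g y) * indicator {0..2 * (y - 1)} x = F x y" for x
      using True by (auto simp: F_def indicator_def)
    moreover have "(2 * (y - 1))\<^sup>2 / 2 * g y = 2 * (y - 1) * f y"
      using True by (simp add: g_def power2_eq_square)
    ultimately show ?thesis
      using True by simp
  next
    case False
    then have "F x y = 0" for x by (cases "y = 1") (auto simp: F_def g_def)
    then show ?thesis using False by (cases "y = 1") auto
  qed
  have eq: "(\<integral>\<^sup>+ x. ennreal (indicator {0<..2} x * (x * h x)) \<partial>lborel)
      = (\<integral>\<^sup>+ y. ennreal (indicator {1..2} y * (2 * (y - 1) * f y)) \<partial>lborel)"
    using swap unfolding inner_x inner_y .
  have "(LBINT x:{0<..2}. x * h x) = enn2real (\<integral>\<^sup>+ x. ennreal (indicator {0<..2} x * (x * h x)) \<partial>lborel)"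
    unfolding set_lebesgue_integral_def real_scaleR_def
  proof (rule integral_eq_nn_integral)
    \<comment> \<open>Measurability of \<open>h\<close> comes from the stationarity equation, which
      expresses it through \<open>f x\<close> and \<open>f (x/2)\<close>.\<close>
    define G where "G t = indicator {0<..2} t * f t" for t
    have [measurable]: "G \<in> borel_measurable lborel"
      unfolding G_def by (rule density_measurable)
    have meas: "(\<lambda>x. indicator {0<..2} x * (x * ((1 + mass_above_1 f) * G x - 1/2 * G (x/2))))
        \<in> borel_measurable lborel"
      by measurable
    have "indicator {0<..2} x * (x * h x)
        = indicator {0<..2} x * (x * ((1 + mass_above_1 f) * G x - 1/2 * G (x/2)))" for x
      using density_gap_operator[of x]
      by (auto simp: G_def h_def gap_operator_def indicator_def)
    with meas show "(\<lambda>x. indicator {0<..2} x * (x * h x)) \<in> borel_measurable lborel"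
      by presburger
    have "0 \<le> h x" if "x \<in> {0<..2}" for x
      unfolding h_def using that by (intro set_lborel_integral_nonneg divide_nonneg_nonneg density_nonneg) auto
    then show "AE x in lborel. 0 \<le> indicator {0<..2} x * (x * h x)"
      by (auto simp: indicator_def)
  qed
  also have "\<dots> = (LBINT y:{1..2}. 2 * (y - 1) * f y)"
    unfolding set_lebesgue_integral_def real_scaleR_def eq
  proof (rule integral_eq_nn_integral[symmetric])
    have "(\<lambda>y. indicator {1..2} y * (2 * (y - 1) * (indicator {0<..2} y * f y))) \<in> borel_measurable lborel"
      using density_measurable by measurable
    moreover have "indicator {1..2} y * (2 * (y - 1) * (indicator {0<..2} y * f y))
        = indicator {1..2} y * (2 * (y - 1) * f y)" for y
      by (auto simp: indicator_def)
    ultimately show "(\<lambda>y. indicator {1..2} y * (2 * (y - 1) * f y)) \<in> borel_measurable lborel"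
      by (simp only:)
    show "AE y in lborel. 0 \<le> indicator {1..2} y * (2 * (y - 1) * f y)"
      using density_nonneg by (auto simp: indicator_def)
  qed
  finally show ?thesis
    by (simp add: h_def)
qed

text \<open>Multiply the stationarity equation by \<open>x\<close> and integrate. The halved
  argument contributes twice the first moment over (0,1], the tail integral twice that over [1,2]
  minus twice the mass there.\<close>

lemma mean_eq:
  "(1 + mass_above_1 f) * (LBINT t:{0<..2}. t * f t) = 2 * (LBINT t:{0<..2}. t * f t) - 2 * mass_above_1 f"
proof -
  let ?E = "LBINT t:{0<..2}. t * f t"
  have int: "set_integrable lborel A (\<lambda>t. t * f t)" if "A \<in> sets lborel" "A \<subseteq> {0<..2}" for A
    using set_integrable_subset[OF mult_density_integrable] that by auto
  have int': "set_integrable lborel {1..2} f"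
    by (rule set_integrable_subset[OF density_integrable]) auto
  \<comment> \<open>Restricting to (0,1] makes \<open>G (x/2)\<close> live exactly on (0,2].
    Substituting \<open>x = 2 * t\<close> then gives the factor 4.\<close>
  define G where "G t = indicator {0<..1} t * (t * f t)" for t
  have G: "integrable lborel G"
    using int[of "{0<..1}"] by (simp add: set_integrable_def G_def[abs_def] subset_eq)
  have scale: "2 * G (x/2) = indicator {0<..2} x * (x * f (x/2))" for x
    by (auto simp: G_def indicator_def)
  have "integrable lborel (\<lambda>x. 2 * G (0 + (1/2) * x))"
    by (intro integrable_mult_right lborel_integrable_real_affine G) auto
  then have half: "set_integrable lborel {0<..2} (\<lambda>x. x * f (x/2))"
    by (simp add: scale set_integrable_def)
  have "integral\<^sup>L lborel G = \<bar>1/2\<bar> *\<^sub>R (\<integral>x. G (0 + (1/2) * x) \<partial>lborel)"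
    by (rule lborel_integral_real_affine) simp
  then have "4 * integral\<^sup>L lborel G = (\<integral>x. 2 * G (x/2) \<partial>lborel)"
    by simp
  then have half_eq: "(LBINT x:{0<..2}. x * f (x/2)) = 4 * (LBINT x:{0<..1}. x * f x)"
    unfolding scale by (simp add: set_lebesgue_integral_def G_def[abs_def])
  have "(LBINT x:{0<..2}. x * (LBINT y:{1 + x/2..2}. f y / (y - 1)))
      = (LBINT x:{0<..2}. (1 + mass_above_1 f) * (x * f x) - 1/2 * (x * f (x/2)))"
    using density_gap_operator
    by (intro set_lebesgue_integral_cong) (auto simp: gap_operator_def algebra_simps)
  also have "\<dots> = (1 + mass_above_1 f) * ?E - 1/2 * (4 * (LBINT x:{0<..1}. x * f x))"
    unfolding half_eq[symmetric]
    by (subst set_integral_diff) (auto intro!: set_integrable_mult_right mult_density_integrable half simp only: set_integral_mult_right)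
  finally have lhs: "(LBINT y:{1..2}. 2 * (y - 1) * f y)
      = (1 + mass_above_1 f) * ?E - 2 * (LBINT x:{0<..1}. x * f x)"
    unfolding tail_integral_moment by simp
  have "(LBINT y:{1..2}. 2 * (y - 1) * f y) = (LBINT y:{1..2}. 2 * (y * f y) - 2 * f y)"
    by (intro set_lebesgue_integral_cong) (auto simp: algebra_simps)
  also have "\<dots> = (LBINT y:{1..2}. 2 * (y * f y)) - (LBINT y:{1..2}. 2 * f y)"
    by (intro set_integral_diff set_integrable_mult_right int int') auto
  also have "\<dots> = 2 * (LBINT y:{1..2}. y * f y) - 2 * mass_above_1 f"
    by (simp add: mass_above_1_def)
  finally have rhs: "(LBINT y:{1..2}. 2 * (y - 1) * f y) = 2 * (LBINT y:{1..2}. y * f y) - 2 * mass_above_1 f" .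
  have "?E = (LBINT y:{0<..1} \<union> {1<..2}. y * f y)"
    by (rule arg_cong[where f = "\<lambda>A. LBINT y:A. y * f y"]) auto
  also have "\<dots> = (LBINT y:{0<..1}. y * f y) + (LBINT y:{1..2}. y * f y)"
    unfolding set_lborel_integral_Ioc_eq_Icc[of 1, symmetric]
    by (intro set_integral_Un int) auto
  finally show ?thesis
    using lhs rhs by simp
qed


lemma mean_pos: "0 < (LBINT t:{0<..2}. t * f t)"
proof -
  have "(LBINT t:{0<..2}. t * f t) \<noteq> 0"
  proof
    assume "(LBINT t:{0<..2}. t * f t) = 0"
    then have "AE t in lborel. indicator {0<..2} t *\<^sub>R (t * f t) = 0"
      using mult_density_integrable density_nonneg unfolding set_lebesgue_integral_def set_integrable_def
      by (subst (asm) integral_nonneg_eq_0_iff_AE) (auto simp: indicator_def)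
    then have "AE t in lborel. indicator {0<..2} t *\<^sub>R f t = 0"
      by eventually_elim (auto simp: indicator_def)
    then have "(LBINT t:{0<..2}. f t) = 0"
      unfolding set_lebesgue_integral_def by (rule integral_eq_zero_AE)
    then show False using density_integral by simp
  qed
  moreover have "0 \<le> (LBINT t:{0<..2}. t * f t)"
    using density_nonneg by (intro set_lborel_integral_nonneg) auto
  ultimately show ?thesis by simp
qed

text \<open>With zero mass above 1, \<open>mean_eq\<close> would read \<open>E = 2 * E\<close>,
  against a positive mean.\<close>

lemma mass_above_1_pos: "0 < mass_above_1 f"
proof -
  have "mass_above_1 f \<noteq> 0"
    using mean_eq mean_pos by auto
  then show ?thesis using mass_above_1_nonneg by simp
qed

text \<open>If all tail integrals vanished, so would the integral of
  \<open>2 * (y - 1) * f y\<close> over [1,2], forcing \<open>f\<close> to be zero almost everywhere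
  there.\<close>

lemma tail_integral_pos:
  obtains x where "x \<in> {0<..2}" and "0 < (LBINT y:{1 + x/2..2}. f y / (y - 1))"
proof (rule ccontr)
  assume "\<not> thesis"
  with that have le: "(LBINT y:{1 + x/2..2}. f y / (y - 1)) \<le> 0" if "x \<in> {0<..2}" for x
    using \<open>x \<in> {0<..2}\<close> not_less by blast
  have eq0: "(LBINT y:{1 + x/2..2}. f y / (y - 1)) = 0" if "x \<in> {0<..2}" for x
    using le[OF that] that
    by (intro antisym set_lborel_integral_nonneg divide_nonneg_nonneg density_nonneg) auto
  have "(LBINT x:{0<..2}. x * (LBINT y:{1 + x/2..2}. f y / (y - 1))) = (LBINT x:{0<..2::real}. 0)"
    using eq0 by (intro set_lebesgue_integral_cong) auto
  then have "(LBINT y:{1..2}. 2 * (y - 1) * f y) = 0"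
    unfolding tail_integral_moment by simp
  moreover have "set_integrable lborel {1..2} (\<lambda>y. 2 * (y - 1) * f y)"
  proof -
    have "set_integrable lborel {1..2} (\<lambda>y. 2 * (y * f y) - 2 * f y)"
      by (intro set_integral_diff set_integrable_mult_right
          set_integrable_subset[OF mult_density_integrable] set_integrable_subset[OF density_integrable]) auto
    then show ?thesis by (simp add: algebra_simps)
  qed
  ultimately have "AE y in lborel. indicator {1..2} y *\<^sub>R (2 * (y - 1) * f y) = 0"
    using density_nonneg unfolding set_lebesgue_integral_def set_integrable_def
    by (subst (asm) integral_nonneg_eq_0_iff_AE) (auto simp: indicator_def)
  moreover have "AE y in lborel. y \<noteq> (1::real)"
    by (rule AE_lborel_singleton)
  ultimately have "AE y in lborel. indicator {1..2} y *\<^sub>R f y = 0"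
    by eventually_elim (auto simp: indicator_def)
  then have "mass_above_1 f = 0"
    unfolding mass_above_1_def set_lebesgue_integral_def by (rule integral_eq_zero_AE)
  then show False using mass_above_1_pos by simp
qed

lemma density_ge_half: "x \<in> {0<..2} \<Longrightarrow> f (x/2) / 2 \<le> (1 + mass_above_1 f) * f x"
proof -
  assume x: "x \<in> {0<..2}"
  then have "0 \<le> (LBINT y:{1 + x/2..2}. f y / (y - 1))"
    by (intro set_lborel_integral_nonneg divide_nonneg_nonneg density_nonneg) auto
  then show ?thesis
    using density_gap_operator[OF x] by (simp add: gap_operator_def)
qed

lemma density_ge_tail: "x \<in> {0<..2} \<Longrightarrow> (LBINT y:{1 + x/2..2}. f y / (y - 1)) \<le> (1 + mass_above_1 f) * f x"
  using density_gap_operator[of x] density_nonneg[of "x/2"] by (simp add: gap_operator_def)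

section \<open>Lower bounds for the density\<close>

text \<open>Tail integrals grow as \<open>x\<close> decreases, so one positive tail integral bounds
  \<open>f\<close> below near 0. \<open>density_ge_half\<close> carries the bound from
  \<open>x/2\<close> to \<open>x\<close>, losing a factor \<open>2 * ?lam\<close> each time.\<close>

lemma density_bounded_below:
  obtains c where "0 < c" and "\<And>x. x \<in> {0<..2} \<Longrightarrow> c \<le> f x"
proof -
  let ?h = "\<lambda>x. LBINT y:{1 + x/2..2}. f y / (y - 1)"
  let ?lam = "1 + mass_above_1 f"
  have lam: "0 < ?lam" using mass_above_1_pos by simp
  obtain x0 where x0: "x0 \<in> {0<..2}" "0 < ?h x0" by (rule tail_integral_pos)
  have near_0: "?h x0 / ?lam \<le> f x" if x: "x \<in> {0<..2}" "x \<le> x0" for x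
  proof -
    have "?h x0 \<le> ?h x"
      unfolding set_lebesgue_integral_def
    proof (rule integral_mono)
      show "integrable lborel (\<lambda>y. indicator {1 + x0/2..2} y *\<^sub>R (f y / (y - 1)))"
        "integrable lborel (\<lambda>y. indicator {1 + x/2..2} y *\<^sub>R (f y / (y - 1)))"
        using set_integrable_gap_kernel[OF density_integrable] x x0 by (auto simp: set_integrable_def)
      show "indicator {1 + x0/2..2} y *\<^sub>R (f y / (y - 1)) \<le> indicator {1 + x/2..2} y *\<^sub>R (f y / (y - 1))" for y
        using x x0 density_nonneg[of y] by (auto simp: indicator_def)
    qed
    also have "\<dots> \<le> ?lam * f x" by (rule density_ge_tail[OF x(1)])
    finally show ?thesis using lam by (simp add: field_simps)
  qed
  have scaled: "?h x0 / ?lam / (2 * ?lam) ^ n \<le> f x" if "x \<in> {0<..2}" "x / 2 ^ n \<le> x0" for n x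
    using that
  proof (induction n arbitrary: x)
    case 0
    then show ?case using near_0 by simp
  next
    case (Suc n)
    have "?h x0 / ?lam / (2 * ?lam) ^ n \<le> f (x/2)"
      using Suc.prems by (intro Suc.IH) auto
    also have "\<dots> \<le> (2 * ?lam) * f x"
      using density_ge_half[OF Suc.prems(1)] by (simp add: algebra_simps)
    finally have "?h x0 / ?lam / (2 * ?lam) ^ n / (2 * ?lam) \<le> f x"
      using lam by (subst pos_divide_le_eq) (auto simp: mult.commute)
    then show ?case by (simp add: mult_ac)
  qed
  \<comment> \<open>After \<open>n\<close> halvings every point of (0,2] lies below
    \<open>x0\<close>, so finitely many doublings suffice uniformly.\<close>
  obtain n where n: "2 / x0 < 2 ^ n" using real_arch_pow[of 2 "2 / x0"] by auto
  show thesis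
  proof (rule that)
    show "0 < ?h x0 / ?lam / (2 * ?lam) ^ n" using x0 lam by simp
    fix x :: real assume x: "x \<in> {0<..2}"
    have "x \<le> x0 * 2 ^ n" using x x0 n by (simp add: field_simps)
    then show "?h x0 / ?lam / (2 * ?lam) ^ n \<le> f x"
      using x by (intro scaled) (auto simp: field_simps)
  qed
qed

text \<open>Putting the constant lower bound into the tail integral yields
  \<open>- c * ln (x/2)\<close>, which supplies the logarithmic growth at 0.\<close>

lemma density_ge_log:
  obtains c where "0 < c" and "\<And>x. x \<in> {0<..2} \<Longrightarrow> c * (1 + \<bar>ln x\<bar>) \<le> f x"
proof -
  let ?lam = "1 + mass_above_1 f"
  have lam: "1 \<le> ?lam" using mass_above_1_pos by simp
  obtain c where c: "0 < c" "\<And>x. x \<in> {0<..2} \<Longrightarrow> c \<le> f x"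
    by (rule density_bounded_below) blast
  show thesis
  proof (rule that)
    show "0 < c / (2 * ?lam)" using c lam by simp
    fix x :: real assume x: "x \<in> {0<..2}"
    have tail: "c * - ln (x/2) \<le> ?lam * f x"
    proof -
      \<comment> \<open>With both coefficients zero the trial function is the constant 1 on
        (1,2].\<close>
      have b: "has_bochner_integral lborel
          (\<lambda>y. c * (indicator {1 + x/2..2} y *\<^sub>R (trial 1 0 0 y / (y - 1)))) (c * - ln (x/2))"
        using has_bochner_integral_trial_kernel[OF x, of 1 0 0] by (intro has_bochner_integral_mult_right) simp
      have "c * - ln (x/2) = (\<integral>y. c * (indicator {1 + x/2..2} y *\<^sub>R (trial 1 0 0 y / (y - 1))) \<partial>lborel)"
        using b by (rule has_bochner_integral_integral_eq[symmetric])
      also have "\<dots> \<le> (LBINT y:{1 + x/2..2}. f y / (y - 1))"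
        unfolding set_lebesgue_integral_def
      proof (rule integral_mono)
        show "integrable lborel (\<lambda>y. c * (indicator {1 + x/2..2} y *\<^sub>R (trial 1 0 0 y / (y - 1))))"
          using b by (rule integrable.intros)
        show "integrable lborel (\<lambda>y. indicator {1 + x/2..2} y *\<^sub>R (f y / (y - 1)))"
          using set_integrable_gap_kernel[OF density_integrable] x by (auto simp: set_integrable_def)
        show "c * (indicator {1 + x/2..2} y *\<^sub>R (trial 1 0 0 y / (y - 1)))
            \<le> indicator {1 + x/2..2} y *\<^sub>R (f y / (y - 1))" for y
          using x c(2)[of y] by (auto simp: indicator_def trial_def intro!: divide_right_mono)
      qed
      also have "\<dots> \<le> ?lam * f x" by (rule density_ge_tail[OF x])
      finally show ?thesis .
    qed
    have fx: "c \<le> f x" by (rule c(2)[OF x])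
    have "f x \<le> ?lam * f x" using fx c(1) mass_above_1_pos by (simp add: algebra_simps)
    moreover have "c * \<bar>ln x\<bar> \<le> ?lam * f x"
    proof (cases "x \<le> 1")
      case True
      then have "\<bar>ln x\<bar> \<le> - ln (x/2)" using x by (simp add: ln_div)
      then have "c * \<bar>ln x\<bar> \<le> c * - ln (x/2)" using c(1) by (intro mult_left_mono) auto
      then show ?thesis using tail by simp
    next
      case False
      then have "0 \<le> ln x" "ln x \<le> ln 2" using x by auto
      then have "\<bar>ln x\<bar> \<le> 1" using ln_2_less_1 by simp
      then have "c * \<bar>ln x\<bar> \<le> c * 1" using c(1) by (intro mult_left_mono) auto
      then show ?thesis using fx \<open>f x \<le> ?lam * f x\<close> by simp
    qed
    ultimately have "c * (1 + \<bar>ln x\<bar>) \<le> 2 * ?lam * f x"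
      using fx by (simp add: algebra_simps)
    then show "c / (2 * ?lam) * (1 + \<bar>ln x\<bar>) \<le> f x"
      using lam by (simp add: field_simps)
  qed
qed

section \<open>Numerical bounds and the decay rate\<close>

lemma mass_above_1_upper: "1 + mass_above_1 f \<le> 1239/1000"
proof -
  have "log_power_form f" using stat by (simp add: stationary_gap_density_def)
  then obtain B where B: "0 \<le> B" "\<And>t. t \<in> {0<..2} \<Longrightarrow> \<bar>f t\<bar> \<le> B * (1 + \<bar>ln t\<bar>)"
    by (rule log_power_form_bound) blast
  obtain c where c: "0 < c" "\<And>x. x \<in> {0<..2} \<Longrightarrow> c \<le> f x" by (rule density_bounded_below) blast
  show ?thesis
  \<comment> \<open>The factor 5 undoes the 1/5 in \<open>trial_ge_log\<close>.\<close>
  proof (rule eigenvalue_upper_bound[where K = "5 * B", OF density_integrable density_gap_operator])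
    fix x :: real assume x: "x \<in> {0<..2}"
    have "B * (1/5 * (1 + \<bar>ln x\<bar>)) \<le> B * trial (1239/1000) (- 22/25) (3/10) x"
      using trial_ge_log[OF x] B(1) by (rule mult_left_mono)
    then show "f x \<le> 5 * B * trial (1239/1000) (- 22/25) (3/10) x"
      using B(2)[OF x] by simp
  next
    show "0 < f 2" using c(1) c(2)[of 2] by simp
  qed (use mass_above_1_pos B(1) log_branch_le_trial in auto)
qed

lemma mass_above_1_lower: "1227/1000 \<le> 1 + mass_above_1 f"
proof -
  obtain c where c: "0 < c" "\<And>x. x \<in> {0<..2} \<Longrightarrow> c * (1 + \<bar>ln x\<bar>) \<le> f x"
    by (rule density_ge_log) blast
  show ?thesis
  \<comment> \<open>The divisor 2 undoes the 2 in \<open>trial_le_log\<close>.\<close>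
  proof (rule eigenvalue_lower_bound[where K = "c/2", OF density_integrable density_gap_operator])
    fix x :: real assume x: "x \<in> {0<..2}"
    have "c/2 * trial (1227/1000) (- 21/25) (1/4) x \<le> c/2 * (2 * (1 + \<bar>ln x\<bar>))"
      using trial_le_log[OF x] c(1) by (intro mult_left_mono) auto
    then show "c/2 * trial (1227/1000) (- 21/25) (1/4) x \<le> f x"
      using c(2)[OF x] by (simp add: algebra_simps)
  next
    show "0 < trial (1227/1000) (- 21/25) (1/4) 2" by (simp add: trial_def)
  qed (use mass_above_1_pos c(1) trial_le_log_branch in auto)
qed

end

theorem mainTheorem4:
  fixes M :: "'a measure" and X :: "'a \<Rightarrow> real" and f :: "real \<Rightarrow> real"
  assumes "stationary_gap_density f"
    and "prob_space M"
    and "distributed M lborel X (\<lambda>t. ennreal (f t * indicator {0<..2} t))"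
  shows "measure M {\<omega> \<in> space M. X \<omega> > 1} = (LBINT t:{1..2}. f t) \<and>
         (LINT \<omega>|M. X \<omega>) = (LBINT t:{0<..2}. t * f t) \<and>
         \<bar>decay_rate M X - 0.616445\<bar> \<le> 0.0035"
proof -
  let ?E = "LBINT t:{0<..2}. t * f t"
  have X[measurable]: "X \<in> borel_measurable M"
    using distributed_measurable[OF assms(3)] by simp
  have nonneg: "0 \<le> f t * indicator {0<..2} t" for t
    using density_nonneg[OF assms(1)] by (auto simp: indicator_def)
  have dist: "(\<integral>t. f t * indicator {0<..2} t * g t \<partial>lborel) = (\<integral>\<omega>. g (X \<omega>) \<partial>M)"
    if "g \<in> borel_measurable lborel" for g :: "real \<Rightarrow> real"
    using distributed_integral[OF assms(3) that] nonneg by simp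
  have "measure M {\<omega> \<in> space M. X \<omega> > 1} = (\<integral>\<omega>. indicator {1<..} (X \<omega>) \<partial>M)"
  proof -
    have "(\<integral>\<omega>. indicator {1<..} (X \<omega>) \<partial>M) = (\<integral>\<omega>. indicator {\<omega> \<in> space M. X \<omega> > 1} \<omega> \<partial>M)"
      by (intro Bochner_Integration.integral_cong) (auto simp: indicator_def)
    also have "\<dots> = measure M {\<omega> \<in> space M. X \<omega> > 1}"
      by (simp add: Int_absorb2 subset_eq)
    finally show ?thesis by simp
  qed
  also have "\<dots> = (LBINT t:{1<..2}. f t)"
    unfolding dist[of "indicator {1<..}", symmetric, simplified] set_lebesgue_integral_def
    by (intro Bochner_Integration.integral_cong) (auto simp: indicator_def)
  also have "\<dots> = (LBINT t:{1..2}. f t)"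
    by (rule set_lborel_integral_Ioc_eq_Icc)
  finally have P: "measure M {\<omega> \<in> space M. X \<omega> > 1} = (LBINT t:{1..2}. f t)" .
  have "(LINT \<omega>|M. X \<omega>) = (\<integral>t. f t * indicator {0<..2} t * t \<partial>lborel)"
    using dist[of "\<lambda>t. t"] by simp
  also have "\<dots> = ?E"
    by (simp add: set_lebesgue_integral_def mult_ac)
  finally have E: "(LINT \<omega>|M. X \<omega>) = ?E" .
  have "decay_rate M X = 1 - mass_above_1 f / ?E"
    by (simp add: decay_rate_def P E mass_above_1_def)
  \<comment> \<open>Divide the identity \<open>mean_eq\<close> by twice the mean, which is
    positive.\<close>
  also have "\<dots> = (1 + mass_above_1 f) / 2"
    using mean_eq[OF assms(1)] mean_pos[OF assms(1)] by (simp add: field_simps)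
  \<comment> \<open>The rate lies in [0.6135, 0.6195], inside the allowed interval
    [0.612945, 0.619945].\<close>
  finally have "\<bar>decay_rate M X - 0.616445\<bar> \<le> 0.0035"
    using mass_above_1_upper[OF assms(1)] mass_above_1_lower[OF assms(1)] by (intro abs_leI) (simp_all add: field_simps)
  with P E show ?thesis by simp
qed

end
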